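(* Let $X=(X_t,\mathbf{P}^x)$ be a right Markov process on a state space $E$ and assume that $X$ is irreducible. Then the symmetrizing measure of $X$ is unique up to a constant. More precisely, if both $\mu$ and $\nu$ are non-trivial (i.e. not identically zero) symmetrizing measures of $X$, then $\nu=c\mu$ for some constant $c>0$.
   Context: $X=(X_t,\mathbf{P}^x)$ is a general right Markov process on a state space $E$ with transition semigroup $(P_t)_{t>0}$. For a set $D$, $T_D$ denotes the hitting time of $D$ by $X$. The fine topology is the one determined by the process $X$. The process $X$ is called irreducible if $\mathbf{P}^x(T_D<\infty)>0$ for every $x\in E$ and every non-empty finely open subset $D\subseteq E$. A $\sigma$-finite measure $\mu$ on $E$ is called a symmetrizing measure of $X$ (and $X$ is called $\mu$-symmetric) if $(P_tu,v)_\mu=(u,P_tv)_\mu$ for all measurable $u,v\ge 0$ and all $t>0$, where $(f,g)_\mu=\int_E fg\,d\mu$. *)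

theory Defs
  imports "HOL-Probability.Probability"
begin

text \<open>Right processes are taken in the sense of Sharpe, General Theory of Markov Processes.\<close>

definition univ_completion :: "'a measure \<Rightarrow> 'a measure" where
  "univ_completion M = sigma (space M)
     {A. A \<subseteq> space M \<and> (\<forall>m. finite_measure m \<and> sets m = sets M \<longrightarrow> A \<in> sets (completion m))}"

lemma sets_univ_completion:
  "sets (univ_completion M) =
     {A. A \<subseteq> space M \<and> (\<forall>m. finite_measure m \<and> sets m = sets M \<longrightarrow> A \<in> sets (completion m))}"
  (is "_ = ?U")
proof -
  have sp: "space m = space M" if "sets m = sets M" for m
    using that by (rule sets_eq_imp_space_eq)
  have "sigma_algebra (space M) ?U"
    unfolding sigma_algebra_iff2
  proof (intro conjI ballI allI impI)
    show "?U \<subseteq> Pow (space M)" by auto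
    show "{} \<in> ?U" by auto
    fix A assume A: "A \<in> ?U"
    have "space M - A \<in> sets (completion m)" if "finite_measure m" "sets m = sets M" for m
    proof -
      have "A \<in> sets (completion m)" using A that by auto
      then have "space (completion m) - A \<in> sets (completion m)" by (rule sets.compl_sets)
      then show ?thesis by (simp add: sp[OF that(2)])
    qed
    then show "space M - A \<in> ?U" by auto
  next
    fix A :: "nat \<Rightarrow> _" assume "range A \<subseteq> ?U"
    then show "(\<Union>i. A i) \<in> ?U" by (auto intro!: sets.countable_UN)
  qed
  then show ?thesis
    unfolding univ_completion_def by (simp add: sigma_algebra.sets_measure_of_eq)
qed

lemma space_univ_completion [simp]: "space (univ_completion M) = space M"
  unfolding univ_completion_def by (simp add: space_measure_of_conv)

abbreviation uborel :: "'a::topological_space measure" where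
  "uborel \<equiv> univ_completion borel"

text \<open>The state space is the whole type. A Radon space is a space homeomorphic to a universally
  measurable subset of a compact metric space. Every compact metric space embeds in the Hilbert
  cube, so only compact subsets of the (metrizable) product space of real sequences are needed.\<close>

definition radon_space :: "'e::topological_space itself \<Rightarrow> bool" where
  "radon_space _ \<longleftrightarrow> (\<exists>K S :: (nat \<Rightarrow> real) set. compact K \<and>
     S \<in> sets (univ_completion (restrict_space borel K)) \<and> (UNIV :: 'e set) homeomorphic S)"

text \<open>The cemetery is \<open>None\<close>; functions on the state space vanish there.\<close>

definition ext0 :: "('e \<Rightarrow> ennreal) \<Rightarrow> 'e option \<Rightarrow> ennreal" where
  "ext0 f z = (case z of None \<Rightarrow> 0 | Some x \<Rightarrow> f x)"

definition kernel_op :: "(real \<Rightarrow> 'e \<Rightarrow> 'e measure) \<Rightarrow> real \<Rightarrow> ('e \<Rightarrow> ennreal) \<Rightarrow> 'e \<Rightarrow> ennreal" where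
  "kernel_op p t f x = (\<integral>\<^sup>+ y. f y \<partial>p t x)"

definition transition_semigroup :: "(real \<Rightarrow> 'e::topological_space \<Rightarrow> 'e measure) \<Rightarrow> bool" where
  "transition_semigroup p \<longleftrightarrow>
     (\<forall>t>0. p t \<in> uborel \<rightarrow>\<^sub>M subprob_algebra uborel) \<and>
     (\<forall>s>0. \<forall>t>0. \<forall>x. p (s + t) x = p s x \<bind> p t)"

definition excessive ::
    "(real \<Rightarrow> 'e::topological_space \<Rightarrow> 'e measure) \<Rightarrow> real \<Rightarrow> ('e \<Rightarrow> ennreal) \<Rightarrow> bool" where
  "excessive p \<alpha> f \<longleftrightarrow> f \<in> borel_measurable uborel \<and>
     (\<forall>x. (\<forall>t>0. ennreal (exp (- \<alpha> * t)) * kernel_op p t f x \<le> f x) \<and>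
          ((\<lambda>t. ennreal (exp (- \<alpha> * t)) * kernel_op p t f x) \<longlongrightarrow> f x) (at_right 0))"

text \<open>Right continuity of a path in the state space with the cemetery adjoined as an isolated
  absorbing point.\<close>

definition right_path :: "(real \<Rightarrow> 'e::topological_space option) \<Rightarrow> bool" where
  "right_path w \<longleftrightarrow> (\<forall>t\<ge>0. case w t of
       None \<Rightarrow> \<forall>s\<ge>t. w s = None
     | Some x \<Rightarrow> \<forall>U. open U \<and> x \<in> U \<longrightarrow> (\<forall>\<^sub>F s in at_right t. w s \<in> Some ` U))"

text \<open>In the locale below, \<open>m \<bind> P\<close> is the law of the process with initial law \<open>m\<close>. Paths live in
  the state space up to their lifetime, and the kernels \<open>p t\<close> are sub-Markovian accordingly.
  The assumption \<open>excessive_right_continuous\<close> is Sharpe's second hypothesis (HD2). The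
  filtration need not be augmented.\<close>

locale right_process =
  fixes G :: "'w measure"
    and Gt :: "real \<Rightarrow> 'w measure"
    and X :: "real \<Rightarrow> 'w \<Rightarrow> 'e::topological_space option"
    and \<theta> :: "real \<Rightarrow> 'w \<Rightarrow> 'w"
    and P :: "'e \<Rightarrow> 'w measure"
    and p :: "real \<Rightarrow> 'e \<Rightarrow> 'e measure"
  assumes radon: "radon_space TYPE('e)"
    and semigroup: "transition_semigroup p"
    and filtration: "\<And>t. 0 \<le> t \<Longrightarrow> subalgebra G (Gt t)"
      "\<And>s t. 0 \<le> s \<Longrightarrow> s \<le> t \<Longrightarrow> subalgebra (Gt t) (Gt s)"
    and adapted: "\<And>t A. 0 \<le> t \<Longrightarrow> A \<in> sets uborel \<Longrightarrow>
      {\<omega> \<in> space G. X t \<omega> \<in> Some ` A} \<in> sets (Gt t)"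
    and paths: "\<And>\<omega>. \<omega> \<in> space G \<Longrightarrow> right_path (\<lambda>t. X t \<omega>)"
    and shift: "\<And>t \<omega>. 0 \<le> t \<Longrightarrow> \<omega> \<in> space G \<Longrightarrow> \<theta> t \<omega> \<in> space G"
      "\<And>s t \<omega>. 0 \<le> s \<Longrightarrow> 0 \<le> t \<Longrightarrow> \<omega> \<in> space G \<Longrightarrow> X s (\<theta> t \<omega>) = X (s + t) \<omega>"
    and kernel: "P \<in> uborel \<rightarrow>\<^sub>M prob_algebra G"
    and start: "\<And>x. AE \<omega> in P x. X 0 \<omega> = Some x"
    and markov: "\<And>m s t f. m \<in> space (prob_algebra uborel) \<Longrightarrow> 0 \<le> t \<Longrightarrow> 0 < s \<Longrightarrow>
      f \<in> borel_measurable uborel \<Longrightarrow>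
      AE \<omega> in m \<bind> P. nn_cond_exp (m \<bind> P) (Gt t) (\<lambda>\<omega>. ext0 f (X (t + s) \<omega>)) \<omega>
                        = ext0 (kernel_op p s f) (X t \<omega>)"
    and excessive_right_continuous: "\<And>m \<alpha> f. m \<in> space (prob_algebra uborel) \<Longrightarrow> 0 < \<alpha> \<Longrightarrow>
      excessive p \<alpha> f \<Longrightarrow>
      AE \<omega> in m \<bind> P. \<forall>t\<ge>0. ((\<lambda>s. ext0 f (X s \<omega>)) \<longlongrightarrow> ext0 f (X t \<omega>)) (at_right t)"

definition fine_topology :: "(real \<Rightarrow> 'e::topological_space \<Rightarrow> 'e measure) \<Rightarrow> 'e topology" where
  "fine_topology p = topology_generated_by {f -` U | f U \<alpha>. 0 \<le> \<alpha> \<and> excessive p \<alpha> f \<and> open U}"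

definition hitting_time :: "(real \<Rightarrow> 'w \<Rightarrow> 'e option) \<Rightarrow> 'e set \<Rightarrow> 'w \<Rightarrow> ereal" where
  "hitting_time X D \<omega> = Inf (ereal ` {t. 0 < t \<and> X t \<omega> \<in> Some ` D})"

text \<open>A finely open set may fail to be measurable, so the probability of hitting it is an outer
  probability; it is the probability in the completion of \<open>P x\<close> whenever the event belongs to it.\<close>

definition irreducible_process ::
    "(real \<Rightarrow> 'w \<Rightarrow> 'e::topological_space option) \<Rightarrow> ('e \<Rightarrow> 'w measure) \<Rightarrow>
     (real \<Rightarrow> 'e \<Rightarrow> 'e measure) \<Rightarrow> bool" where
  "irreducible_process X P p \<longleftrightarrow>
     (\<forall>x D. openin (fine_topology p) D \<and> D \<noteq> {} \<longrightarrow>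
        outer_measure_of (P x) {\<omega> \<in> space (P x). hitting_time X D \<omega> < \<infinity>} > 0)"

definition symmetrizing ::
    "(real \<Rightarrow> 'e::topological_space \<Rightarrow> 'e measure) \<Rightarrow> 'e measure \<Rightarrow> bool" where
  "symmetrizing p \<mu> \<longleftrightarrow> sets \<mu> = sets uborel \<and> sigma_finite_measure \<mu> \<and>
     (\<forall>t>0. \<forall>u \<in> borel_measurable uborel. \<forall>v \<in> borel_measurable uborel.
        (\<integral>\<^sup>+ x. kernel_op p t u x * v x \<partial>\<mu>) = (\<integral>\<^sup>+ x. u x * kernel_op p t v x \<partial>\<mu>))"

end

theory Submission
  imports Defs
begin

text \<open>
  Fix the process and write \<open>g\<^sub>A\<close> for the \<open>1\<close>-potential of a Borel set \<open>A\<close>, that is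
  \<open>g\<^sub>A x = \<integral> exp (- t) p\<^sub>t(x, A) dt\<close> over \<open>t > 0\<close>. Three facts about it give the uniqueness.

  \<^item> \<open>g\<^sub>A\<close> is \<open>1\<close>-excessive, so \<open>{g\<^sub>A > 0}\<close> is finely open. If it is not empty, irreducibility sends
    the process into it from every starting point with positive probability; since \<open>g\<^sub>A\<close> is right
    continuous along paths, the process is then in it at some rational time, and excessivity turns
    this into \<open>g\<^sub>A x > 0\<close>. Hence \<open>g\<^sub>A\<close> vanishes identically or nowhere
    (\<open>excessive_pos_everywhere\<close>).

  \<^item> A symmetrizing measure \<open>\<mu>\<close> satisfies \<open>\<integral>\<^sub>B g\<^sub>A d\<mu> = \<integral>\<^sub>A g\<^sub>B d\<mu>\<close>, by Fubini
    (\<open>potential_symmetric\<close>). Taking \<open>B\<close> to be the whole space, whose potential is positive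
    everywhere, shows that for \<open>\<mu> \<noteq> 0\<close> the Borel \<open>\<mu>\<close>-null sets are the sets of zero potential
    (\<open>symmetrizing_null_iff\<close>). This description does not involve \<open>\<mu>\<close>, so any other
    non-trivial symmetrizing measure has the form \<open>\<nu> = h \<mu>\<close>.

  \<^item> Suppose that some number \<open>a\<close> separates \<open>h\<close>: there are non-null \<open>A \<subseteq> {h < a}\<close> and
    \<open>B \<subseteq> {h \<ge> a}\<close>. Symmetry with respect to \<open>\<nu>\<close> and to \<open>\<mu>\<close> gives
    \<open>\<integral>\<^sub>A h g\<^sub>B d\<mu> = \<integral>\<^sub>B h g\<^sub>A d\<mu> \<ge> a \<integral>\<^sub>B g\<^sub>A d\<mu> = a \<integral>\<^sub>A g\<^sub>B d\<mu>\<close>, which contradicts \<open>h < a\<close> on \<open>A\<close>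
    because \<open>g\<^sub>B\<close> is positive everywhere (\<open>density_separation\<close>). So \<open>h\<close> is almost
    everywhere constant.

  The potential integrates over time, so it has to be known that \<open>p\<^sub>t(x, A)\<close> is jointly measurable
  in \<open>t\<close> and \<open>x\<close>. Right continuity of the paths gives this for Borel sets \<open>A\<close> only, whereas
  \<open>\<mu>\<close>, \<open>\<nu>\<close> and \<open>h\<close> live on the universally measurable sets; \<open>inner_borel\<close> mediates
  between the two \<open>\<sigma>\<close>-algebras.
\<close>

section \<open>Almost everywhere constant functions\<close>

lemma AE_imp_ex:
  assumes "emeasure M (space M) \<noteq> 0" and "AE x in M. Q x"
  shows "\<exists>x. Q x"
proof (rule ccontr)
  assume "\<not> ?thesis"
  with assms(2) have "AE x in M. False" by (auto elim!: eventually_mono)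
  then show False using assms(1)
    by (simp add: eventually_ae_filter null_sets_def)
       (metis emeasure_space sets.sets_into_space subset_antisym)
qed

text \<open>The rational cuts determine the value of \<open>h\<close>, and there are only countably many of them, so
  almost every point has the same cuts as one fixed point.\<close>

lemma AE_const_of_cuts:
  fixes h :: "'a \<Rightarrow> ennreal"
  assumes "emeasure M (space M) \<noteq> 0"
    and cut: "\<And>a. a \<noteq> \<infinity> \<Longrightarrow> (AE x in M. h x < a) \<or> (AE x in M. \<not> h x < a)"
  obtains c where "AE x in M. h x = c"
proof -
  have "\<exists>b. AE x in M. (h x < ennreal (real_of_rat q)) = b" for q
    using cut[of "ennreal (real_of_rat q)"] by auto
  then obtain b where b: "\<And>q. AE x in M. (h x < ennreal (real_of_rat q)) = b q" by metis
  then have ae: "AE x in M. \<forall>q. (h x < ennreal (real_of_rat q)) = b q"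
    by (simp add: AE_all_countable)
  obtain x0 where x0: "\<And>q. (h x0 < ennreal (real_of_rat q)) = b q"
    using AE_imp_ex[OF assms(1) ae] by blast
  have dense: "\<exists>q. u < ennreal (real_of_rat q) \<and> ennreal (real_of_rat q) < v" if "u < v" for u v
    using that ennreal_rat_dense by blast
  have "AE x in M. h x = h x0"
    using ae
  proof eventually_elim
    case (elim x)
    then have "(h x < ennreal (real_of_rat q)) = (h x0 < ennreal (real_of_rat q))" for q using x0 by simp
    then show ?case using dense[of "h x" "h x0"] dense[of "h x0" "h x"]
      by (metis less_asym linorder_less_linear)
  qed
  then show ?thesis by (rule that)
qed

section \<open>Universally measurable sets\<close>

lemma borel_subset_uborel: "sets (borel :: 'e::topological_space measure) \<subseteq> sets uborel"
proof
  fix A :: "'e set" assume A: "A \<in> sets borel"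
  have "A \<in> sets (completion m)" if "sets m = sets borel" for m
    using A that by (simp add: sets_completionI_sets)
  then show "A \<in> sets uborel"
    using A by (auto simp: sets_univ_completion)
qed

lemma sets_uborelI [measurable (raw)]: "A \<in> sets borel \<Longrightarrow> A \<in> sets uborel"
  using borel_subset_uborel by blast

text \<open>Membership in the universal completion only speaks of finite measures on the Borel sets, so \<open>M\<close>
  is first replaced by an equivalent finite measure and then restricted to the Borel sets.\<close>

lemma inner_borel:
  fixes M :: "'e::topological_space measure"
  assumes M: "sets M = sets uborel" and "sigma_finite_measure M" and A: "A \<in> sets uborel"
  obtains S where "S \<in> sets borel" "S \<subseteq> A" "A - S \<in> null_sets M"
proof -
  interpret sigma_finite_measure M by fact
  have sp: "space M = UNIV"
    using sets_eq_imp_space_eq[OF M] by simp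
  obtain h where h [measurable]: "h \<in> borel_measurable M" and fin: "integral\<^sup>N M h \<noteq> \<infinity>"
    and pos: "\<And>x. 0 < h x"
    using Ex_finite_integrable_function sp by auto
  define D where "D = density M h"
  have [simp]: "sets D = sets M" "space D = UNIV"
    by (auto simp: D_def sp)
  have "finite_measure D"
    using fin emeasure_density[OF h, of "space M"]
    by (intro finite_measureI) (simp add: D_def cong: nn_integral_cong)
  have sub: "subalgebra D borel"
    using borel_subset_uborel by (auto simp: subalgebra_def M)
  define m where "m = restr_to_subalg D borel"
  have "finite_measure m" "sets m = sets borel"
    unfolding m_def using sub \<open>finite_measure D\<close>
    by (auto simp: sets_restr_to_subalg intro: finite_measure_restr_to_subalg)
  then have "A \<in> sets (completion m)"
    using A by (auto simp: sets_univ_completion)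
  then obtain S N N' where S: "A = S \<union> N" "N \<subseteq> N'" "N' \<in> null_sets m" "S \<in> sets m"
    by (rule sets_completionE)
  have "N' \<in> null_sets D"
    using S(3) sub by (simp add: m_def null_sets_restr_to_subalg)
  then have N': "N' \<in> null_sets M"
    unfolding D_def null_sets_density_iff[OF h] using pos
    by (auto simp: sp AE_iff_null_sets not_le[symmetric] dest!: AE_not_in) 
  have "A - S \<in> null_sets M"
  proof (rule null_sets_subset[OF N'])
    show "A - S \<in> sets M"
      using A S(4) \<open>sets m = sets borel\<close> by (auto simp: M intro: sets_uborelI)
    show "A - S \<subseteq> N'" using S by auto
  qed
  with S \<open>sets m = sets borel\<close> show ?thesis
    by (intro that[of S]) auto
qed

lemma inner_borel_finite:
  fixes M :: "'e::topological_space measure"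
  assumes M: "sets M = sets uborel" and "sigma_finite_measure M" and A: "A \<in> sets uborel"
    and pos: "emeasure M A \<noteq> 0"
  obtains S where "S \<in> sets borel" "S \<subseteq> A" "emeasure M S \<noteq> 0" "emeasure M S \<noteq> \<infinity>"
proof -
  interpret sigma_finite_measure M by fact
  have [measurable]: "A \<in> sets M" using A M by simp
  obtain F :: "nat \<Rightarrow> 'e set" where F: "range F \<subseteq> sets M" "(\<Union>i. F i) = space M"
      "\<And>i. emeasure M (F i) \<noteq> \<infinity>" 
    using sigma_finite by metis
  have [measurable]: "F i \<in> sets M" for i using F by auto
  have "\<exists>i. emeasure M (A \<inter> F i) \<noteq> 0"
  proof (rule ccontr)
    assume "\<not> ?thesis"
    then have "(\<Union>i. A \<inter> F i) \<in> null_sets M" by (intro null_sets_UN) (auto simp: null_sets_def)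
    also have "(\<Union>i. A \<inter> F i) = A" using F(2) sets.sets_into_space[of A M] by auto
    finally show False using pos by auto
  qed
  then obtain i where i: "emeasure M (A \<inter> F i) \<noteq> 0" by auto
  have "A \<inter> F i \<in> sets uborel" using M[symmetric] by simp
  then obtain S where S: "S \<in> sets borel" "S \<subseteq> A \<inter> F i" "A \<inter> F i - S \<in> null_sets M"
    using inner_borel[OF assms(1,2)] by blast
  have [measurable]: "S \<in> sets M" using S M by (simp add: sets_uborelI)
  have "emeasure M (A \<inter> F i) = emeasure M S"
  proof -
    have "emeasure M (S \<union> (A \<inter> F i - S)) = emeasure M S"
      by (rule emeasure_Un_null_set) (use S in auto)
    moreover have "S \<union> (A \<inter> F i - S) = A \<inter> F i" using S by auto
    ultimately show ?thesis by simp
  qed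
  moreover have "emeasure M S \<le> emeasure M (F i)"
    using S by (intro emeasure_mono) auto
  ultimately show ?thesis
    using i S F(3)[of i] by (intro that[of S]) (auto simp: top_unique)
qed

text \<open>A Radon space inherits a metric from the sequence space; the approximating functions are truncated
  multiples of the distance to the complement.\<close>

lemma continuous_approx_open:
  fixes U :: "'e::topological_space set"
  assumes "radon_space TYPE('e)" and U: "open U"
  obtains f :: "nat \<Rightarrow> 'e \<Rightarrow> ennreal"
  where "\<And>n. continuous_on UNIV (f n)" "\<And>n x. f n x \<le> 1"
    "\<And>x. (\<lambda>n. f n x) \<longlonglongrightarrow> indicator U x"
proof -
  obtain S :: "(nat \<Rightarrow> real) set" and h k where hk: "homeomorphism (UNIV :: 'e set) S h k"
    using assms(1) by (auto simp: radon_space_def homeomorphic_def)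
  have cont: "continuous_on UNIV h" "continuous_on S k" and kh: "\<And>x. k (h x) = x" "\<And>x. h x \<in> S"
    using hk by (auto simp: homeomorphism_def)
  obtain V where V: "open V" "k -` U \<inter> S = V \<inter> S"
    using continuous_on_open_invariant[THEN iffD1, OF cont(2), rule_format, OF U] by blast
  have mem: "x \<in> U \<longleftrightarrow> h x \<in> V" for x
    using V(2) kh[of x] by (metis (no_types, lifting) Int_iff vimage_eq)
  show ?thesis
  proof (cases "V = UNIV")
    \<comment> \<open>The distance to the empty set is \<open>0\<close> by convention, so the formula below fails here.\<close>
    case True
    then show ?thesis using mem by (intro that[of "\<lambda>_ _. 1"]) auto
  next
    case False
    define f where "f n x = ennreal (min 1 (real n * infdist (h x) (- V)))" for n x
    show ?thesis
    proof (rule that[of f])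
      show "continuous_on UNIV (f n)" for n
        unfolding f_def
        by (intro continuous_on_ennreal continuous_on_min continuous_on_mult continuous_on_const
            continuous_on_infdist cont)
      show "f n x \<le> 1" for n x
        by (auto simp: f_def ennreal_le_1)
      show "(\<lambda>n. f n x) \<longlonglongrightarrow> indicator U x" for x
      proof (cases "x \<in> U")
        case False
        then have "infdist (h x) (- V) = 0" using mem by simp
        then show ?thesis using False by (simp add: f_def)
      next
        case True
        then have "0 < infdist (h x) (- V)"
          using mem V(1) False by (intro infdist_pos_not_in_closed) auto
        then obtain N where "1 < real N * infdist (h x) (- V)"
          using reals_Archimedean3 by blast
        then have "f n x = 1" if "n \<ge> N" for n
        proof -
          have "real N * infdist (h x) (- V) \<le> real n * infdist (h x) (- V)"
            using that by (intro mult_right_mono) (auto simp: infdist_nonneg)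
          then show ?thesis using \<open>1 < _\<close> by (simp add: f_def)
        qed
        then show ?thesis
          using True by (intro tendsto_eventually) (auto simp: eventually_sequentially)
      qed
    qed
  qed
qed

section \<open>The laws of the process at fixed times\<close>

lemma right_path_tendsto:
  assumes "right_path w" "0 \<le> t" and f: "continuous_on UNIV f"
  shows "((\<lambda>s. ext0 f (w s)) \<longlongrightarrow> ext0 f (w t)) (at_right t)"
proof (cases "w t")
  case None
  then have "\<And>s. s \<ge> t \<Longrightarrow> w s = None"
    using assms(1,2) by (force simp: right_path_def)
  then have "\<forall>\<^sub>F s in at_right t. ext0 f (w s) = ext0 f (w t)"
    by (auto simp: eventually_at_filter None)
  then show ?thesis by (rule tendsto_eventually)
next
  case (Some x)
  show ?thesis
  proof (rule topological_tendstoI)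
    fix V assume V: "open V" "ext0 f (w t) \<in> V"
    then have "open (f -` V)" "x \<in> f -` V"
      using f Some by (auto simp: ext0_def open_vimage)
    then have "\<forall>\<^sub>F s in at_right t. w s \<in> Some ` (f -` V)"
      using assms(1,2) Some by (force simp: right_path_def)
    then show "\<forall>\<^sub>F s in at_right t. ext0 f (w s) \<in> V"
      by eventually_elim (auto simp: ext0_def)
  qed
qed

lemma measurable_uborel_of_borel: "f \<in> borel_measurable borel \<Longrightarrow> f \<in> borel_measurable uborel"
  by (auto simp: measurable_def intro: sets_uborelI)

lemma semigroup_kernelD:
  assumes "transition_semigroup p" "0 < t"
  shows "sets (p t x) = sets uborel" "space (p t x) = UNIV" "emeasure (p t x) A \<le> 1"
    "p t \<in> uborel \<rightarrow>\<^sub>M subprob_algebra uborel"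
proof -
  show *: "p t \<in> uborel \<rightarrow>\<^sub>M subprob_algebra uborel"
    using assms by (auto simp: transition_semigroup_def)
  then have **: "p t x \<in> space (subprob_algebra uborel)"
    by (auto dest: measurable_space)
  then show "sets (p t x) = sets uborel" by (simp add: space_subprob_algebra)
  then show "space (p t x) = UNIV" using sets_eq_imp_space_eq by fastforce
  interpret subprob_space "p t x" using ** by (simp add: space_subprob_algebra)
  show "emeasure (p t x) A \<le> 1" by (rule subprob_emeasure_le_1)
qed

text \<open>The \<open>1\<close>-resolvent of the semigroup, applied to the indicator of \<open>A\<close>.\<close>

definition potential :: "(real \<Rightarrow> 'e \<Rightarrow> 'e measure) \<Rightarrow> 'e set \<Rightarrow> 'e \<Rightarrow> ennreal" where
  "potential p A x =
     (\<integral>\<^sup>+ t. ennreal (exp (- t)) * (indicator {0<..} t * emeasure (p t x) A) \<partial>lborel)"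

context right_process
begin

lemma P_x: "prob_space (P x)" "sets (P x) = sets G" "space (P x) = space G"
proof -
  have "P x \<in> space (prob_algebra G)"
    using kernel by (auto dest: measurable_space)
  then show "prob_space (P x)" and *: "sets (P x) = sets G"
    by (auto simp: space_prob_algebra)
  show "space (P x) = space G" using sets_eq_imp_space_eq[OF *] .
qed

text \<open>The Markov property and the right continuity of excessive functions are stated for initial laws;
  the unit mass at \<open>x\<close> recovers \<open>P x\<close>.\<close>

lemma bind_point: "return uborel x \<in> space (prob_algebra uborel)" "return uborel x \<bind> P = P x"
  using measurable_prob_algebraD[OF kernel]
  by (auto simp: space_prob_algebra prob_space_return bind_return)

lemma measurable_ext0_X:
  assumes f: "f \<in> borel_measurable uborel" and t: "0 \<le> t"
  shows "(\<lambda>\<omega>. ext0 f (X t \<omega>)) \<in> borel_measurable (Gt t)"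
proof (rule measurableI)
  have sp: "space (Gt t) = space G" using filtration(1)[OF t] by (simp add: subalgebra_def)
  fix A :: "ennreal set" assume A: "A \<in> sets borel"
  have V: "{\<omega> \<in> space G. X t \<omega> \<in> Some ` (f -` B)} \<in> sets (Gt t)" if "B \<in> sets borel" for B
    using adapted[OF t, of "f -` B"] measurable_sets[OF f that] by simp
  have N: "{\<omega> \<in> space G. X t \<omega> \<in> Some ` UNIV} \<in> sets (Gt t)"
    using adapted[OF t, of UNIV] by (simp add: sets_uborelI)
  have "(\<lambda>\<omega>. ext0 f (X t \<omega>)) -` A \<inter> space (Gt t) =
     (if 0 \<in> A then {\<omega> \<in> space G. X t \<omega> \<in> Some ` (f -` A)} \<union> (space (Gt t) - {\<omega> \<in> space G. X t \<omega> \<in> Some ` UNIV})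
      else {\<omega> \<in> space G. X t \<omega> \<in> Some ` (f -` A)})"
    using sp by (auto simp: ext0_def split: option.splits)
  also have "\<dots> \<in> sets (Gt t)" using V[OF A] N by auto
  finally show "(\<lambda>\<omega>. ext0 f (X t \<omega>)) -` A \<inter> space (Gt t) \<in> sets (Gt t)" .
qed auto

lemma measurable_ext0_X' [measurable]:
  assumes "f \<in> borel_measurable uborel" "0 \<le> t"
  shows "(\<lambda>\<omega>. ext0 f (X t \<omega>)) \<in> borel_measurable (P x)"
  using measurable_ext0_X[OF assms] filtration(1)[OF assms(2)] P_x[of x]
  by (auto simp: measurable_def subalgebra_def)

text \<open>This is the Markov property at time \<open>0\<close>, where the process sits at \<open>x\<close>.\<close>

lemma expectation_X:
  assumes f: "f \<in> borel_measurable uborel" and t: "0 < t"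
  shows "(\<integral>\<^sup>+ \<omega>. ext0 f (X t \<omega>) \<partial>P x) = kernel_op p t f x"
proof -
  interpret prob_space "P x" by (rule P_x)
  interpret finite_measure_subalgebra "P x" "Gt 0"
    using filtration(1)[of 0] P_x[of x] by unfold_locales (auto simp: subalgebra_def)
  have "AE \<omega> in P x. nn_cond_exp (P x) (Gt 0) (\<lambda>\<omega>. ext0 f (X t \<omega>)) \<omega>
                        = ext0 (kernel_op p t f) (X 0 \<omega>)"
    using markov[OF bind_point(1)[of x] order_refl t f] unfolding bind_point(2) add_0_left .
  with start[of x] have *: "AE \<omega> in P x. nn_cond_exp (P x) (Gt 0) (\<lambda>\<omega>. ext0 f (X t \<omega>)) \<omega>
                        = kernel_op p t f x"
    by eventually_elim (simp add: ext0_def)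
  have "(\<integral>\<^sup>+ \<omega>. ext0 f (X t \<omega>) \<partial>P x) = (\<integral>\<^sup>+ \<omega>. 1 * ext0 f (X t \<omega>) \<partial>P x)" by simp
  also have "\<dots> = (\<integral>\<^sup>+ \<omega>. 1 * nn_cond_exp (P x) (Gt 0) (\<lambda>\<omega>. ext0 f (X t \<omega>)) \<omega> \<partial>P x)"
    using f t by (intro nn_cond_exp_intg[symmetric] measurable_ext0_X') auto
  also have "\<dots> = (\<integral>\<^sup>+ \<omega>. kernel_op p t f x \<partial>P x)"
    using * by (intro nn_integral_cong_AE) auto
  finally show ?thesis by (simp add: emeasure_space_1)
qed

text \<open>Dominated convergence along right continuous paths. The limit is kept as an expectation because
  \<open>t = 0\<close> is included and the semigroup has no kernel at time \<open>0\<close>.\<close>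

lemma expectation_right_continuous:
  assumes f: "continuous_on UNIV f" "\<And>x. f x \<le> 1" and t: "0 \<le> t"
    and s: "s \<longlonglongrightarrow> t" "\<And>n. t < s n"
  shows "(\<lambda>n. kernel_op p (s n) f x) \<longlonglongrightarrow> (\<integral>\<^sup>+ \<omega>. ext0 f (X t \<omega>) \<partial>P x)"
proof -
  interpret prob_space "P x" by (rule P_x)
  have fm: "f \<in> borel_measurable uborel"
    using f(1) by (intro measurable_uborel_of_borel borel_measurable_continuous_onI)
  have lim: "filterlim s (at_right t) sequentially"
    using s by (auto simp: filterlim_at less_imp_neq[THEN not_sym] intro!: always_eventually)
  have "(\<lambda>n. \<integral>\<^sup>+ \<omega>. ext0 f (X (s n) \<omega>) \<partial>P x) \<longlonglongrightarrow> (\<integral>\<^sup>+ \<omega>. ext0 f (X t \<omega>) \<partial>P x)"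
  proof (rule nn_integral_dominated_convergence[where w = "\<lambda>_. 1"])
    show "(\<lambda>\<omega>. ext0 f (X (s i) \<omega>)) \<in> borel_measurable (P x)" for i
      using fm t s(2)[of i] by (intro measurable_ext0_X') auto
    show "(\<lambda>\<omega>. ext0 f (X t \<omega>)) \<in> borel_measurable (P x)"
      using fm t by (intro measurable_ext0_X') auto
    show "AE \<omega> in P x. ext0 f (X (s j) \<omega>) \<le> 1" for j
      using f(2) by (auto simp: ext0_def split: option.splits)
    show "AE \<omega> in P x. (\<lambda>i. ext0 f (X (s i) \<omega>)) \<longlonglongrightarrow> ext0 f (X t \<omega>)"
    proof (rule AE_I2)
      fix \<omega> assume "\<omega> \<in> space (P x)"
      then have "right_path (\<lambda>t. X t \<omega>)" using paths P_x by auto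
      from filterlim_compose[OF right_path_tendsto[OF this t f(1)] lim]
      show "(\<lambda>i. ext0 f (X (s i) \<omega>)) \<longlonglongrightarrow> ext0 f (X t \<omega>)" .
    qed
  qed (auto simp: emeasure_space_1)
  moreover have "0 < s n" for n using t s(2)[of n] by simp
  ultimately show ?thesis using expectation_X[OF fm] by simp
qed

lemma measurable_kernel_op:
  assumes "f \<in> borel_measurable uborel" "0 < t"
  shows "kernel_op p t f \<in> borel_measurable uborel"
  unfolding kernel_op_def
  using semigroup_kernelD(4)[OF semigroup assms(2)] assms(1)
  by (rule measurable_compose[OF _ nn_integral_measurable_subprob_algebra])

section \<open>Joint measurability of the semigroup\<close>

text \<open>A right continuous function of time is the limit of its discretizations at the points of a
  grid lying strictly to the right, and each discretization takes countably many times only.\<close>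

lemma joint_measurable_continuous:
  assumes f: "continuous_on UNIV f" "\<And>x. f x \<le> 1"
  shows "(\<lambda>(t, x). indicator {0<..} t * kernel_op p t f x) \<in> borel_measurable (borel \<Otimes>\<^sub>M uborel)"
proof -
  have fm: "f \<in> borel_measurable uborel"
    using f(1) by (intro measurable_uborel_of_borel borel_measurable_continuous_onI)
  define s where "s n t = (of_int \<lfloor>real (Suc n) * t\<rfloor> + 1) / real (Suc n)" for n t
  have s: "t < s n t" "s n t \<le> t + 1 / real (Suc n)" for n t
  proof -
    have fl: "of_int \<lfloor>real (Suc n) * t\<rfloor> \<le> real (Suc n) * t"
        "real (Suc n) * t < of_int \<lfloor>real (Suc n) * t\<rfloor> + 1"
      by linarith+
    have N: "0 < real (Suc n)" by simp
    show "t < s n t"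
      unfolding s_def pos_less_divide_eq[OF N] using fl by (simp only: mult.commute)
    show "s n t \<le> t + 1 / real (Suc n)"
      unfolding s_def add_divide_distrib
      using fl(1) by (intro add_mono) (simp_all only: pos_divide_le_eq[OF N] mult.commute order_refl)
  qed
  have "(\<lambda>z. indicator {0<..} (fst z) * kernel_op p (s n (fst z)) f (snd z)) \<in> borel_measurable (borel \<Otimes>\<^sub>M uborel)" for n
  proof -
    \<comment> \<open>A negative index would give a grid point \<open>\<le> 0\<close>, where nothing is assumed about the kernels.\<close>
    define H where "H k x = (if k < 0 then 0 else kernel_op p ((of_int k + 1) / real (Suc n)) f x)" for k :: int and x
    have H: "H k \<in> borel_measurable uborel" for k
    proof (cases "k < 0")
      case False
      then have "0 < (of_int k + 1) / real (Suc n)" by (simp add: field_simps)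
      from measurable_kernel_op[OF fm this] show ?thesis using False by (simp add: H_def[abs_def])
    qed (simp add: H_def[abs_def])
    have "(\<lambda>z. H \<lfloor>real (Suc n) * fst z\<rfloor> (snd z)) \<in> borel_measurable (borel \<Otimes>\<^sub>M uborel)"
      by (rule measurable_compose_countable[where f = "\<lambda>k z. H k (snd z)"])
         (use H in measurable)
    then have "(\<lambda>z. indicator {0<..} (fst z) * H \<lfloor>real (Suc n) * fst z\<rfloor> (snd z)) \<in> borel_measurable (borel \<Otimes>\<^sub>M uborel)"
      by measurable
    also have "(\<lambda>z. indicator {0<..} (fst z) * H \<lfloor>real (Suc n) * fst z\<rfloor> (snd z)) =
      (\<lambda>z. indicator {0<..} (fst z) * kernel_op p (s n (fst z)) f (snd z))"
      by (auto simp: H_def s_def fun_eq_iff indicator_def mult_less_0_iff)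
    finally show ?thesis .
  qed
  moreover have "(\<lambda>n. indicator {0<..} (fst z) * kernel_op p (s n (fst z)) f (snd z)) \<longlonglongrightarrow>
      indicator {0<..} (fst z) * kernel_op p (fst z) f (snd z)" for z
  proof (cases "0 < fst z")
    case True
    have "(\<lambda>n. s n (fst z)) \<longlonglongrightarrow> fst z"
    proof (rule tendsto_sandwich[where f = "\<lambda>_. fst z" and h = "\<lambda>n. fst z + 1 / real (Suc n)"])
      show "(\<lambda>n. fst z + 1 / real (Suc n)) \<longlonglongrightarrow> fst z"
        using tendsto_add[OF tendsto_const[of "fst z"] LIMSEQ_Suc[OF lim_1_over_n]] by simp
      show "(\<lambda>n. fst z) \<longlonglongrightarrow> fst z" by simp
      show "\<forall>\<^sub>F n in sequentially. fst z \<le> s n (fst z)"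
        by (intro always_eventually allI less_imp_le s(1))
      show "\<forall>\<^sub>F n in sequentially. s n (fst z) \<le> fst z + 1 / real (Suc n)"
        by (intro always_eventually allI s(2))
    qed
    from expectation_right_continuous[OF f _ this s(1), of "snd z"] True expectation_X[OF fm True]
    show ?thesis by simp
  qed auto
  ultimately have "(\<lambda>z. indicator {0<..} (fst z) * kernel_op p (fst z) f (snd z)) \<in> borel_measurable (borel \<Otimes>\<^sub>M uborel)"
    by (rule borel_measurable_LIMSEQ_order[rotated])
  then show ?thesis by (simp add: split_beta')
qed

text \<open>Continuous functions yield open sets, and open sets yield Borel sets by Dynkin's argument.\<close>

lemma joint_measurable:
  assumes "A \<in> sets borel"
  shows "(\<lambda>(t, x). indicator {0<..} t * emeasure (p t x) A) \<in> borel_measurable (borel \<Otimes>\<^sub>M uborel)"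
proof -
  define F where "F A z = indicator {0<..} (fst z) * emeasure (p (fst z) (snd z)) A" for A and z :: "real \<times> 'e"
  have open_case: "F U \<in> borel_measurable (borel \<Otimes>\<^sub>M uborel)" if U: "open U" for U
  proof -
    obtain f :: "nat \<Rightarrow> 'e \<Rightarrow> ennreal"
      where f: "\<And>n. continuous_on UNIV (f n)" "\<And>n x. f n x \<le> 1"
        "\<And>x. (\<lambda>n. f n x) \<longlonglongrightarrow> indicator U x"
      using continuous_approx_open[OF radon U] by blast
    have fm: "f n \<in> borel_measurable uborel" for n
      using f(1) by (intro measurable_uborel_of_borel borel_measurable_continuous_onI)
    have "(\<lambda>n. indicator {0<..} (fst z) * kernel_op p (fst z) (f n) (snd z)) \<longlonglongrightarrow> F U z" for z
    proof (cases "0 < fst z")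
      case True
      note k = semigroup_kernelD(1-3)[OF semigroup True, of "snd z"]
      have [measurable_cong]: "sets (p (fst z) (snd z)) = sets uborel" by (rule k)
      have [measurable]: "U \<in> sets uborel" using U by (simp add: sets_uborelI)
      have "(\<lambda>n. \<integral>\<^sup>+ y. f n y \<partial>p (fst z) (snd z)) \<longlonglongrightarrow> (\<integral>\<^sup>+ y. indicator U y \<partial>p (fst z) (snd z))"
        by (rule nn_integral_dominated_convergence[where w = "\<lambda>_. 1"])
           (use f fm k(3)[of UNIV] k(2) in \<open>auto simp: order.strict_iff_order top_unique\<close>)
      then show ?thesis using True k(1) \<open>U \<in> _\<close> by (simp add: F_def kernel_op_def)
    qed (auto simp: F_def)
    moreover have "(\<lambda>z. indicator {0<..} (fst z) * kernel_op p (fst z) (f n) (snd z)) \<in> borel_measurable (borel \<Otimes>\<^sub>M uborel)" for n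
      using joint_measurable_continuous[OF f(1,2)] by (simp add: split_beta')
    ultimately show ?thesis by (rule borel_measurable_LIMSEQ_order)
  qed
  have sb: "sets (borel :: 'e measure) = sigma_sets UNIV {S. open S}"
    by (simp add: borel_def)
  have "Int_stable {S :: 'e set. open S}" "{S :: 'e set. open S} \<subseteq> Pow UNIV" "A \<in> sigma_sets UNIV {S. open S}"
    using assms sb by (auto simp: Int_stable_def)
  then have "F A \<in> borel_measurable (borel \<Otimes>\<^sub>M uborel)"
  proof (induction rule: sigma_sets_induct_disjoint)
    case (basic U)
    then show ?case using open_case by simp
  next
    case empty
    have "F {} = (\<lambda>_. 0)" by (auto simp: F_def)
    then show ?case by simp
  next
    case (compl A)
    then have [measurable]: "A \<in> sets borel" by (simp add: sb)
    have "F (UNIV - A) z = F UNIV z - F A z" for z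
    proof (cases "0 < fst z")
      case True
      note k = semigroup_kernelD(1-3)[OF semigroup True, of "snd z"]
      have "A \<in> sets (p (fst z) (snd z))" using k(1) by (simp add: sets_uborelI)
      moreover have "emeasure (p (fst z) (snd z)) A \<noteq> \<infinity>"
        using k(3)[of A] by (metis ennreal_one_less_top infinity_ennreal_def not_le)
      ultimately show ?thesis
        using True k(2) emeasure_compl[of A "p (fst z) (snd z)"] by (simp add: F_def)
    qed (auto simp: F_def)
    then have "F (UNIV - A) = (\<lambda>z. F UNIV z - F A z)" by auto
    then show ?case using compl open_case[of UNIV] by simp
  next
    case (union A)
    have "F (\<Union>(range A)) z = (\<Sum>i. F (A i) z)" for z
    proof (cases "0 < fst z")
      case True
      note k = semigroup_kernelD(1-3)[OF semigroup True, of "snd z"]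
      have "range A \<subseteq> sets (p (fst z) (snd z))"
        using union(2) k(1) unfolding sb[symmetric] by (auto intro!: sets_uborelI)
      from suminf_emeasure[OF this union(1)] True show ?thesis by (simp add: F_def)
    qed (auto simp: F_def)
    then have "F (\<Union>(range A)) = (\<lambda>z. (\<Sum>i. F (A i) z))" by auto
    then show ?case using union by simp
  qed
  then show ?thesis by (simp add: F_def[abs_def] split_beta')
qed

section \<open>The potential of a Borel set\<close>

lemma joint_measurable_discounted:
  assumes "A \<in> sets borel" and M: "sets M = sets uborel"
  shows "(\<lambda>(t, x). ennreal (exp (- t)) * (indicator {0<..} t * emeasure (p t x) A))
    \<in> borel_measurable (lborel \<Otimes>\<^sub>M M)"
proof -
  have "(\<lambda>z. indicator {0<..} (fst z) * emeasure (p (fst z) (snd z)) A) \<in> borel_measurable (borel \<Otimes>\<^sub>M uborel)"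
    using joint_measurable[OF assms(1)] by (simp add: split_beta')
  then have "(\<lambda>z. indicator {0<..} (fst z) * emeasure (p (fst z) (snd z)) A) \<in> borel_measurable (lborel \<Otimes>\<^sub>M M)"
    by (subst measurable_cong_sets[OF sets_pair_measure_cong[OF sets_lborel M] refl])
  then have "(\<lambda>z. ennreal (exp (- fst z)) * (indicator {0<..} (fst z) * emeasure (p (fst z) (snd z)) A))
    \<in> borel_measurable (lborel \<Otimes>\<^sub>M M)"
    by measurable
  then show ?thesis by (simp add: split_beta')
qed

lemma measurable_discounted:
  assumes "A \<in> sets borel"
  shows "(\<lambda>t. ennreal (exp (- t)) * (indicator {0<..} t * emeasure (p t x) A)) \<in> borel_measurable lborel"
  using measurable_Pair_compose_split[OF joint_measurable_discounted[OF assms refl] measurable_ident measurable_const[of x]]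
  by (simp add: id_def)

lemma measurable_potential:
  assumes "A \<in> sets borel"
  shows "potential p A \<in> borel_measurable uborel"
proof -
  have "(\<lambda>(x, t). ennreal (exp (- t)) * (indicator {0<..} t * emeasure (p t x) A))
    \<in> borel_measurable (uborel \<Otimes>\<^sub>M lborel)"
    using measurable_pair_swap[OF joint_measurable_discounted[OF assms refl]] by (simp add: split_beta')
  from lborel.borel_measurable_nn_integral[OF this] show ?thesis
    unfolding potential_def[abs_def] .
qed

text \<open>Fubini for the potential. The weight \<open>v\<close> serves two purposes: with an indicator it gives the
  symmetry of the potential, with \<open>1\<close> and \<open>M = p s x\<close> its behaviour under the semigroup.\<close>

lemma nn_integral_potential:
  assumes A: "A \<in> sets borel" and M: "sets M = sets uborel" "sigma_finite_measure M"
    and v: "v \<in> borel_measurable uborel"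
  shows "(\<integral>\<^sup>+ x. potential p A x * v x \<partial>M) =
    (\<integral>\<^sup>+ t. ennreal (exp (- t)) * (indicator {0<..} t * (\<integral>\<^sup>+ x. emeasure (p t x) A * v x \<partial>M)) \<partial>lborel)"
proof -
  interpret M: sigma_finite_measure M by fact
  interpret pair_sigma_finite lborel M ..
  have v' [measurable]: "v \<in> borel_measurable M" using v M(1) by (simp cong: measurable_cong_sets)
  have [measurable]: "(\<lambda>z. ennreal (exp (- fst z)) * (indicator {0<..} (fst z) * emeasure (p (fst z) (snd z)) A))
    \<in> borel_measurable (lborel \<Otimes>\<^sub>M M)"
    using joint_measurable_discounted[OF A M(1)] by (simp add: split_beta')
  have J: "(\<lambda>(t, x). (ennreal (exp (- t)) * (indicator {0<..} t * emeasure (p t x) A)) * v x)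
    \<in> borel_measurable (lborel \<Otimes>\<^sub>M M)"
    unfolding split_beta' by measurable
  have meas: "(\<lambda>x. emeasure (p t x) A) \<in> borel_measurable M" if "0 < t" for t
  proof -
    have "A \<in> sets uborel" using A by (rule sets_uborelI)
    from measurable_compose[OF semigroup_kernelD(4)[OF semigroup that] measurable_emeasure_subprob_algebra[OF this]]
    show ?thesis using M(1) by (simp cong: measurable_cong_sets)
  qed
  have "(\<integral>\<^sup>+ x. potential p A x * v x \<partial>M) =
    (\<integral>\<^sup>+ x. (\<integral>\<^sup>+ t. (ennreal (exp (- t)) * (indicator {0<..} t * emeasure (p t x) A)) * v x \<partial>lborel) \<partial>M)"
    unfolding potential_def
    by (intro nn_integral_cong nn_integral_multc[symmetric] measurable_discounted[OF A])
  also have "\<dots> = (\<integral>\<^sup>+ t. (\<integral>\<^sup>+ x. (ennreal (exp (- t)) * (indicator {0<..} t * emeasure (p t x) A)) * v x \<partial>M) \<partial>lborel)"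
    using Fubini'[OF J] .
  also have "\<dots> = (\<integral>\<^sup>+ t. ennreal (exp (- t)) * (indicator {0<..} t * (\<integral>\<^sup>+ x. emeasure (p t x) A * v x \<partial>M)) \<partial>lborel)"
  proof (intro nn_integral_cong)
    fix t :: real
    show "(\<integral>\<^sup>+ x. (ennreal (exp (- t)) * (indicator {0<..} t * emeasure (p t x) A)) * v x \<partial>M) =
      ennreal (exp (- t)) * (indicator {0<..} t * (\<integral>\<^sup>+ x. emeasure (p t x) A * v x \<partial>M))"
    proof (cases "0 < t")
      case True
      then show ?thesis using meas[OF True] v'
        by (simp add: mult.assoc nn_integral_cmult)
    qed simp
  qed
  finally show ?thesis .
qed

lemma potential_symmetric:
  assumes \<mu>: "symmetrizing p \<mu>" and A: "A \<in> sets borel" and B: "B \<in> sets borel"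
  shows "(\<integral>\<^sup>+ x\<in>B. potential p A x \<partial>\<mu>) = (\<integral>\<^sup>+ x\<in>A. potential p B x \<partial>\<mu>)"
proof -
  have M: "sets \<mu> = sets uborel" "sigma_finite_measure \<mu>"
    using \<mu> by (auto simp: symmetrizing_def)
  have ind: "indicator C \<in> borel_measurable uborel" if "C \<in> sets borel" for C
    using that by (intro borel_measurable_indicator sets_uborelI)
  have k: "kernel_op p t (indicator C) x = emeasure (p t x) C" if "0 < t" "C \<in> sets borel" for t x C
    using semigroup_kernelD(1)[OF semigroup that(1)] that by (simp add: kernel_op_def sets_uborelI)
  have "(\<integral>\<^sup>+ x. emeasure (p t x) A * indicator B x \<partial>\<mu>) = (\<integral>\<^sup>+ x. emeasure (p t x) B * indicator A x \<partial>\<mu>)"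
    if "0 < t" for t
  proof -
    have "(\<integral>\<^sup>+ x. kernel_op p t (indicator A) x * indicator B x \<partial>\<mu>) =
        (\<integral>\<^sup>+ x. indicator A x * kernel_op p t (indicator B) x \<partial>\<mu>)"
      using \<mu> that ind[OF A] ind[OF B] unfolding symmetrizing_def by blast
    then show ?thesis using k[OF that A] k[OF that B] by (simp add: mult.commute)
  qed
  then show ?thesis
    unfolding nn_integral_potential[OF A M ind[OF B]] nn_integral_potential[OF B M ind[OF A]]
    by (intro nn_integral_cong) (auto simp: indicator_def)
qed

lemma potential_le_1: "potential p A x \<le> 1"
proof -
  have "potential p A x \<le> (\<integral>\<^sup>+ t. ennreal (t ^ 0 * exp (- t)) * indicator {0..} t \<partial>lborel)"
    unfolding potential_def
  proof (intro nn_integral_mono)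
    fix t :: real
    show "ennreal (exp (- t)) * (indicator {0<..} t * emeasure (p t x) A)
      \<le> ennreal (t ^ 0 * exp (- t)) * indicator {0..} t"
      using semigroup_kernelD(3)[OF semigroup, of t x A]
        mult_left_mono[of "emeasure (p t x) A" 1 "ennreal (exp (- t))"]
      by (auto simp: indicator_def)
  qed
  also have "\<dots> = 1" by (subst nn_intergal_power_times_exp_Ici) simp
  finally show ?thesis .
qed

text \<open>Near time \<open>0\<close> the process is alive with probability close to \<open>1\<close>, whereas a vanishing integral
  would force \<open>p\<^sub>t(x, UNIV) = 0\<close> at times arbitrarily close to \<open>0\<close>.\<close>

lemma potential_UNIV_pos: "0 < potential p UNIV x"
proof (rule ccontr)
  assume "\<not> 0 < potential p UNIV x"
  then have "potential p UNIV x = 0" by simp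
  then have "AE t in lborel. ennreal (exp (- t)) * (indicator {0<..} t * emeasure (p t x) UNIV) = 0"
    unfolding potential_def using measurable_discounted[of UNIV x]
    by (subst (asm) nn_integral_0_iff_AE) simp_all
  then have ae: "AE t in lborel. 0 < t \<longrightarrow> emeasure (p t x) UNIV = 0"
    by eventually_elim (auto simp: indicator_def)
  have "\<exists>t. 0 < t \<and> t < 1 / real (Suc n) \<and> emeasure (p t x) UNIV = 0" for n
  proof (rule ccontr)
    assume "\<not> ?thesis"
    then have "AE t in lborel. t \<notin> {0<..<1 / real (Suc n)}"
      using ae by (auto elim!: eventually_mono)
    then have "emeasure lborel {0<..<1 / real (Suc n)} = 0"
      by (subst (asm) AE_iff_measurable[where N = "{0<..<1 / real (Suc n)}"]) auto
    then show False by simp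
  qed
  then obtain s where s: "\<And>n. 0 < s n" "\<And>n. s n < 1 / real (Suc n)" "\<And>n. emeasure (p (s n) x) UNIV = 0"
    by metis
  have lim: "s \<longlonglongrightarrow> 0"
  proof (rule tendsto_sandwich[where f = "\<lambda>_. 0" and h = "\<lambda>n. 1 / real (Suc n)"])
    show "(\<lambda>n. 1 / real (Suc n)) \<longlonglongrightarrow> 0"
      using LIMSEQ_Suc[OF lim_1_over_n] .
  qed (use s in \<open>auto intro!: always_eventually less_imp_le simp del: of_nat_Suc\<close>)
  have "(\<lambda>n. kernel_op p (s n) (\<lambda>_. 1) x) \<longlonglongrightarrow> (\<integral>\<^sup>+ \<omega>. ext0 (\<lambda>_. 1) (X 0 \<omega>) \<partial>P x)"
    by (rule expectation_right_continuous) (use s lim in auto)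
  moreover have "(\<integral>\<^sup>+ \<omega>. ext0 (\<lambda>_. 1) (X 0 \<omega>) \<partial>P x) = 1"
  proof -
    have "(\<integral>\<^sup>+ \<omega>. ext0 (\<lambda>_. 1) (X 0 \<omega>) \<partial>P x) = (\<integral>\<^sup>+ \<omega>. 1 \<partial>P x)"
      using start[of x] by (intro nn_integral_cong_AE) (auto simp: ext0_def elim!: eventually_mono)
    then show ?thesis using P_x(1)[of x] by (simp add: prob_space.emeasure_space_1)
  qed
  moreover have "kernel_op p (s n) (\<lambda>_. 1) x = 0" for n
    using s(3)[of n] semigroup_kernelD(2)[OF semigroup s(1)[of n], of x] by (simp add: kernel_op_def)
  ultimately have "(\<lambda>_::nat. 0 :: ennreal) \<longlonglongrightarrow> 1" by simp
  then show False by (simp add: LIMSEQ_const_iff)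
qed

text \<open>By the semigroup property, running the process for time \<open>s\<close> cuts off the part of the time integral
  before \<open>s\<close>. Excessivity is then evident, including the limit \<open>s \<rightarrow> 0\<close>.\<close>

lemma discounted_kernel_potential:
  assumes A: "A \<in> sets borel" and s: "0 < s"
  shows "ennreal (exp (- 1 * s)) * kernel_op p s (potential p A) x =
    (\<integral>\<^sup>+ t. ennreal (exp (- t)) * (indicator {s<..} t * emeasure (p t x) A) \<partial>lborel)"
proof -
  note k = semigroup_kernelD(1-3)[OF semigroup s, of x]
  interpret subprob_space "p s x"
    using measurable_space[OF semigroup_kernelD(4)[OF semigroup s], of x] by (simp add: space_subprob_algebra)
  have A': "A \<in> sets uborel" using A by (rule sets_uborelI)
  have sg: "(\<integral>\<^sup>+ y. emeasure (p t y) A \<partial>p s x) = emeasure (p (s + t) x) A" if "0 < t" for t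
  proof -
    have "p t \<in> p s x \<rightarrow>\<^sub>M subprob_algebra uborel"
      using semigroup_kernelD(4)[OF semigroup that] k(1) by (simp cong: measurable_cong_sets)
    moreover have "p (s + t) x = p s x \<bind> p t"
      using semigroup s that by (auto simp: transition_semigroup_def)
    ultimately show ?thesis using A' k(2) by (simp add: emeasure_bind[where N = uborel])
  qed
  have m1: "(\<lambda>t. ennreal (exp (- t)) * (indicator {0<..} t * emeasure (p t x) A)) \<in> borel_measurable lborel"
    by (rule measurable_discounted[OF A])
  have m: "(\<lambda>t. ennreal (exp (- t)) * (indicator {s<..} t * emeasure (p t x) A)) \<in> borel_measurable lborel"
  proof -
    have "(\<lambda>t. indicator {s<..} t * (ennreal (exp (- t)) * (indicator {0<..} t * emeasure (p t x) A))) \<in> borel_measurable lborel"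
      using m1 by measurable
    also have "(\<lambda>t. indicator {s<..} t * (ennreal (exp (- t)) * (indicator {0<..} t * emeasure (p t x) A))) =
      (\<lambda>t. ennreal (exp (- t)) * (indicator {s<..} t * emeasure (p t x) A))"
      using s by (auto simp: indicator_def fun_eq_iff)
    finally show ?thesis .
  qed
  have "kernel_op p s (potential p A) x =
    (\<integral>\<^sup>+ t. ennreal (exp (- t)) * (indicator {0<..} t * (\<integral>\<^sup>+ y. emeasure (p t y) A \<partial>p s x)) \<partial>lborel)"
    using nn_integral_potential[OF A k(1), of "\<lambda>_. 1"] sigma_finite_measure_axioms by (simp add: kernel_op_def)
  also have "\<dots> = (\<integral>\<^sup>+ t. ennreal (exp (- t)) * (indicator {0<..} t * emeasure (p (s + t) x) A) \<partial>lborel)"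
    using sg by (intro nn_integral_cong) (auto simp: indicator_def)
  finally have "ennreal (exp (- 1 * s)) * kernel_op p s (potential p A) x =
     ennreal (exp (- s)) * (\<integral>\<^sup>+ t. ennreal (exp (- t)) * (indicator {0<..} t * emeasure (p (s + t) x) A) \<partial>lborel)"
    by simp
  also have "\<dots> = ennreal (exp (- s)) * (\<integral>\<^sup>+ t. ennreal (exp s) * (ennreal (exp (- (s + 1 * t))) * (indicator {s<..} (s + 1 * t) * emeasure (p (s + 1 * t) x) A)) \<partial>lborel)"
    by (rule arg_cong[where f = "\<lambda>c. ennreal (exp (- s)) * c"], rule nn_integral_cong)
       (auto simp: indicator_def mult.assoc[symmetric] ennreal_mult[symmetric] exp_add[symmetric])
  also have "\<dots> = ennreal (exp (- s)) * (ennreal (exp s) * (\<integral>\<^sup>+ t. ennreal (exp (- (s + 1 * t))) * (indicator {s<..} (s + 1 * t) * emeasure (p (s + 1 * t) x) A) \<partial>lborel))"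
    using measurable_compose[OF _ m, of "\<lambda>t. s + 1 * t" lborel]
    by (subst nn_integral_cmult) auto
  also have "\<dots> = (\<integral>\<^sup>+ t. ennreal (exp (- (s + 1 * t))) * (indicator {s<..} (s + 1 * t) * emeasure (p (s + 1 * t) x) A) \<partial>lborel)"
    by (simp add: mult.assoc[symmetric] ennreal_mult[symmetric] exp_add[symmetric])
  also have "\<dots> = (\<integral>\<^sup>+ t. ennreal (exp (- t)) * (indicator {s<..} t * emeasure (p t x) A) \<partial>lborel)"
    using nn_integral_real_affine[of "\<lambda>t. ennreal (exp (- t)) * (indicator {s<..} t * emeasure (p t x) A)" 1 s] m
    by simp
  finally show ?thesis .
qed

lemma excessive_potential:
  assumes A: "A \<in> sets borel"
  shows "excessive p 1 (potential p A)"
  unfolding excessive_def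
proof (intro conjI allI impI measurable_potential[OF A])
  fix x and s :: real assume s: "0 < s"
  show "ennreal (exp (- 1 * s)) * kernel_op p s (potential p A) x \<le> potential p A x"
    unfolding discounted_kernel_potential[OF A s] unfolding potential_def
    using s by (intro nn_integral_mono) (auto simp: indicator_def)
next
  fix x
  have m1: "(\<lambda>t. ennreal (exp (- t)) * (indicator {0<..} t * emeasure (p t x) A)) \<in> borel_measurable lborel"
    by (rule measurable_discounted[OF A])
  show "((\<lambda>s. ennreal (exp (- 1 * s)) * kernel_op p s (potential p A) x) \<longlongrightarrow> potential p A x) (at_right 0)"
  proof (rule tendsto_at_right_sequentially[of 0 "1::real"])
    fix s :: "nat \<Rightarrow> real" assume s: "\<And>n. 0 < s n" "s \<longlonglongrightarrow> 0"
    have "(\<lambda>n. \<integral>\<^sup>+ t. indicator {s n<..} t * (ennreal (exp (- t)) * (indicator {0<..} t * emeasure (p t x) A)) \<partial>lborel)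
      \<longlonglongrightarrow> (\<integral>\<^sup>+ t. ennreal (exp (- t)) * (indicator {0<..} t * emeasure (p t x) A) \<partial>lborel)"
    proof (rule nn_integral_dominated_convergence[where w = "\<lambda>t. ennreal (exp (- t)) * (indicator {0<..} t * emeasure (p t x) A)"])
      show "(\<integral>\<^sup>+ t. ennreal (exp (- t)) * (indicator {0<..} t * emeasure (p t x) A) \<partial>lborel) < \<infinity>"
        using potential_le_1[of A x] unfolding potential_def[symmetric]
        by (auto simp: less_top[symmetric] top_unique)
      show "AE t in lborel. (\<lambda>n. indicator {s n<..} t * (ennreal (exp (- t)) * (indicator {0<..} t * emeasure (p t x) A)))
        \<longlonglongrightarrow> ennreal (exp (- t)) * (indicator {0<..} t * emeasure (p t x) A)"
      proof (rule AE_I2)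
        fix t :: real
        show "(\<lambda>n. indicator {s n<..} t * (ennreal (exp (- t)) * (indicator {0<..} t * emeasure (p t x) A)))
          \<longlonglongrightarrow> ennreal (exp (- t)) * (indicator {0<..} t * emeasure (p t x) A)"
        proof (cases "0 < t")
          case True
          then have "\<forall>\<^sub>F n in sequentially. s n < t" by (rule order_tendstoD(2)[OF s(2)])
          then show ?thesis by (intro tendsto_eventually) (auto elim!: eventually_mono)
        qed simp
      qed
    qed (use m1 in \<open>auto simp: indicator_def\<close>)
    also have "(\<lambda>n. \<integral>\<^sup>+ t. indicator {s n<..} t * (ennreal (exp (- t)) * (indicator {0<..} t * emeasure (p t x) A)) \<partial>lborel)
      = (\<lambda>n. ennreal (exp (- 1 * s n)) * kernel_op p (s n) (potential p A) x)"
      unfolding discounted_kernel_potential[OF A s(1)]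
    proof (intro ext nn_integral_cong)
      fix n and t :: real
      show "indicator {s n<..} t * (ennreal (exp (- t)) * (indicator {0<..} t * emeasure (p t x) A)) =
        ennreal (exp (- t)) * (indicator {s n<..} t * emeasure (p t x) A)"
        using s(1)[of n] by (auto simp: indicator_def)
    qed
    finally show "(\<lambda>n. ennreal (exp (- 1 * s n)) * kernel_op p (s n) (potential p A) x) \<longlonglongrightarrow> potential p A x"
      unfolding potential_def .
  qed simp
qed

section \<open>Irreducibility and excessive functions\<close>

text \<open>If \<open>g x = 0\<close>, excessivity gives \<open>g (X\<^sub>q) = 0\<close> almost surely at each rational time \<open>q > 0\<close>. A path
  that enters \<open>{g > 0}\<close> stays there for a while by right continuity of \<open>g\<close> along the path, hence
  passes a rational time. So \<open>{g > 0}\<close> is almost surely never hit, and irreducibility makes it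
  empty. Working at rational times avoids the strong Markov property.\<close>

lemma excessive_pos_everywhere:
  assumes irr: "irreducible_process X P p" and g: "excessive p \<alpha> g" and \<alpha>: "0 < \<alpha>" and y: "0 < g y"
  shows "0 < g x"
proof (rule ccontr)
  assume "\<not> 0 < g x"
  then have gx: "g x = 0" by simp
  define D where "D = g -` {0<..}"
  have gm: "g \<in> borel_measurable uborel" using g by (simp add: excessive_def)
  have "openin (fine_topology p) D"
    unfolding fine_topology_def openin_topology_generated_by_iff D_def
  proof (rule generate_topology_on.Basis, unfold mem_Collect_eq, intro exI conjI)
    show "0 \<le> \<alpha>" using \<alpha> by simp
    show "open {0::ennreal<..}" by simp
  qed (use g in simp_all)
  moreover have "D \<noteq> {}" using y by (auto simp: D_def)
  ultimately have hit: "0 < outer_measure_of (P x) {\<omega> \<in> space (P x). hitting_time X D \<omega> < \<infinity>}"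
    using irr by (auto simp: irreducible_process_def)
  have zero: "AE \<omega> in P x. ext0 g (X t \<omega>) = 0" if t: "0 < t" for t
  proof -
    have "ennreal (exp (- \<alpha> * t)) * kernel_op p t g x \<le> g x"
      using g t by (simp add: excessive_def)
    then have "kernel_op p t g x = 0" using gx by simp
    then have "(\<integral>\<^sup>+ \<omega>. ext0 g (X t \<omega>) \<partial>P x) = 0" using expectation_X[OF gm t] by simp
    then show ?thesis
      using measurable_ext0_X'[OF gm, of t x] t by (subst (asm) nn_integral_0_iff_AE) auto
  qed
  have "AE \<omega> in P x. \<forall>q::rat. 0 < real_of_rat q \<longrightarrow> ext0 g (X (real_of_rat q) \<omega>) = 0"
    unfolding AE_all_countable using zero by auto
  moreover have "AE \<omega> in P x. \<forall>t\<ge>0. ((\<lambda>s. ext0 g (X s \<omega>)) \<longlongrightarrow> ext0 g (X t \<omega>)) (at_right t)"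
    using excessive_right_continuous[OF bind_point(1)[of x] \<alpha> g] unfolding bind_point(2) .
  ultimately have "AE \<omega> in P x. \<not> hitting_time X D \<omega> < \<infinity>"
  proof eventually_elim
    case (elim \<omega>)
    have "X t \<omega> \<notin> Some ` D" if t: "0 < t" for t
    proof
      assume "X t \<omega> \<in> Some ` D"
      then have "0 < ext0 g (X t \<omega>)" by (auto simp: ext0_def D_def)
      moreover have "((\<lambda>s. ext0 g (X s \<omega>)) \<longlongrightarrow> ext0 g (X t \<omega>)) (at_right t)"
        using elim(2) t by simp
      ultimately have "\<forall>\<^sub>F s in at_right t. 0 < ext0 g (X s \<omega>)"
        by (intro order_tendstoD(1))
      then obtain b where b: "t < b" "\<And>s. t < s \<Longrightarrow> s < b \<Longrightarrow> 0 < ext0 g (X s \<omega>)"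
        by (auto simp: eventually_at_right_field)
      obtain q where q: "t < real_of_rat q" "real_of_rat q < b"
        using of_rat_dense[OF b(1)] by auto
      have "0 < real_of_rat q" by (rule less_trans[OF t q(1)])
      then show False using b(2)[OF q] elim(1) by auto
    qed
    then have "{t. 0 < t \<and> X t \<omega> \<in> Some ` D} = {}" by auto
    then have "hitting_time X D \<omega> = \<infinity>"
      unfolding hitting_time_def by (simp only: image_empty Inf_empty top_ereal_def)
    then show ?case by simp
  qed
  then obtain N where N: "N \<in> null_sets (P x)" "{\<omega> \<in> space (P x). \<not> \<not> hitting_time X D \<omega> < \<infinity>} \<subseteq> N"
    by (auto elim!: AE_E simp: null_sets_def)
  then have "outer_measure_of (P x) {\<omega> \<in> space (P x). hitting_time X D \<omega> < \<infinity>} \<le> outer_measure_of (P x) N"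
    by (intro outer_measure_of_mono) auto
  also have "\<dots> = 0" using N(1) by (simp add: null_setsD1 null_setsD2)
  finally show False using hit by simp
qed

section \<open>Symmetrizing measures\<close>

text \<open>Symmetry against the whole space reads \<open>\<integral> g\<^sub>A d\<mu> = \<integral>\<^sub>A g d\<mu>\<close> with \<open>g\<close> the potential of the space,
  and \<open>g > 0\<close>. If \<open>\<mu> A = 0\<close>, then \<open>g\<^sub>A\<close> vanishes somewhere, hence everywhere.\<close>

lemma symmetrizing_null_iff:
  assumes irr: "irreducible_process X P p" and \<mu>: "symmetrizing p \<mu>" "emeasure \<mu> (space \<mu>) \<noteq> 0"
    and A: "A \<in> sets borel"
  shows "emeasure \<mu> A = 0 \<longleftrightarrow> (\<forall>x. potential p A x = 0)"
proof -
  have M: "sets \<mu> = sets uborel" using \<mu> by (auto simp: symmetrizing_def)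
  have A' [measurable]: "A \<in> sets \<mu>" using A M by (simp add: sets_uborelI)
  have pm [measurable]: "potential p B \<in> borel_measurable \<mu>" if "B \<in> sets borel" for B
    using measurable_potential[OF that] M by (simp cong: measurable_cong_sets)
  have sym: "(\<integral>\<^sup>+ x. potential p A x \<partial>\<mu>) = (\<integral>\<^sup>+ x\<in>A. potential p UNIV x \<partial>\<mu>)"
    using potential_symmetric[OF \<mu>(1) A, of UNIV] by simp
  show ?thesis
  proof
    assume "emeasure \<mu> A = 0"
    then have "(\<integral>\<^sup>+ x\<in>A. potential p UNIV x \<partial>\<mu>) = 0"
      by (intro nn_integral_null_set null_setsI) auto
    then have "(\<integral>\<^sup>+ x. potential p A x \<partial>\<mu>) = 0" using sym by simp
    then have ae: "AE x in \<mu>. potential p A x = 0"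
      using pm[OF A] by (simp add: nn_integral_0_iff_AE)
    show "\<forall>x. potential p A x = 0"
    proof (rule ccontr)
      assume "\<not> ?thesis"
      then have pos: "0 < potential p A x" for x
        using excessive_pos_everywhere[OF irr excessive_potential[OF A]] by (metis not_gr_zero zero_less_one)
      obtain x where "potential p A x = 0" using AE_imp_ex[OF \<mu>(2) ae] by blast
      with pos[of x] show False by simp
    qed
  next
    assume "\<forall>x. potential p A x = 0"
    then have "(\<integral>\<^sup>+ x\<in>A. potential p UNIV x \<partial>\<mu>) = 0" using sym by simp
    then have "AE x in \<mu>. potential p UNIV x * indicator A x = 0"
      using pm[of UNIV] by (subst (asm) nn_integral_0_iff_AE) auto
    then have "AE x in \<mu>. x \<notin> A"
      using potential_UNIV_pos by (auto simp: less_le elim!: eventually_mono)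
    then show "emeasure \<mu> A = 0"
      by (subst (asm) AE_iff_measurable[OF A']) (use sets.sets_into_space[OF A'] in \<open>auto simp: Collect_conj_eq Int_absorb1\<close>)
  qed
qed

text \<open>A zero-one law for the level sets of the density. The set \<open>A\<close> is chosen of finite measure so that
  the integrals over it are finite and the strict inequality \<open>h < a\<close> survives integration.\<close>

lemma density_separation:
  assumes irr: "irreducible_process X P p" and \<mu>: "symmetrizing p \<mu>" "emeasure \<mu> (space \<mu>) \<noteq> 0"
    and h: "h \<in> borel_measurable \<mu>" and \<nu>: "symmetrizing p (density \<mu> h)" and a: "a \<noteq> \<infinity>"
  shows "(AE x in \<mu>. h x < a) \<or> (AE x in \<mu>. \<not> h x < a)"
proof (rule ccontr)
  assume neg: "\<not> ?thesis"
  have M: "sets \<mu> = sets uborel" "sigma_finite_measure \<mu>" using \<mu> by (auto simp: symmetrizing_def)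
  have sp: "space \<mu> = UNIV" using sets_eq_imp_space_eq[OF M(1)] by simp
  note [measurable] = h
  have pm: "potential p B \<in> borel_measurable \<mu>" if "B \<in> sets borel" for B
    using measurable_potential[OF that] M by (simp cong: measurable_cong_sets)
  have "{x \<in> space \<mu>. h x < a} \<in> sets \<mu>" "{x \<in> space \<mu>. \<not> h x < a} \<in> sets \<mu>" by measurable
  then have sets: "{x. h x < a} \<in> sets uborel" "{x. \<not> h x < a} \<in> sets uborel" by (simp_all add: sp M)
  have "emeasure \<mu> {x. h x < a} \<noteq> 0"
    using neg sets by (subst (asm) (2) AE_iff_measurable[OF _ refl]) (auto simp: M sp)
  then obtain A where A: "A \<in> sets borel" "A \<subseteq> {x. h x < a}" "emeasure \<mu> A \<noteq> 0" "emeasure \<mu> A \<noteq> \<infinity>"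
    by (rule inner_borel_finite[OF M sets(1)])
  have "emeasure \<mu> {x. \<not> h x < a} \<noteq> 0"
    using neg sets by (subst (asm) (1) AE_iff_measurable[OF _ refl]) (auto simp: M sp)
  then obtain B where B: "B \<in> sets borel" "B \<subseteq> {x. \<not> h x < a}" "emeasure \<mu> B \<noteq> 0" "emeasure \<mu> B \<noteq> \<infinity>"
    by (rule inner_borel_finite[OF M sets(2)])
  have [measurable]: "A \<in> sets \<mu>" "B \<in> sets \<mu>" using A B M by (auto intro: sets_uborelI)
  note [measurable] = pm[OF A(1)] pm[OF B(1)]
  have pos: "0 < potential p B x" for x
    using symmetrizing_null_iff[OF irr \<mu> B(1)] B(3) excessive_pos_everywhere[OF irr excessive_potential[OF B(1)]]
    by (metis not_gr_zero zero_less_one)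
  have dens: "(\<integral>\<^sup>+ x\<in>C. potential p C' x \<partial>density \<mu> h) = (\<integral>\<^sup>+ x\<in>C. h x * potential p C' x \<partial>\<mu>)"
    if "C \<in> sets borel" "C' \<in> sets borel" for C C'
  proof -
    have [measurable]: "C \<in> sets \<mu>" using that M by (auto intro: sets_uborelI)
    note [measurable] = pm[OF that(2)]
    show ?thesis by (simp add: nn_integral_density mult.assoc)
  qed
  have "(\<integral>\<^sup>+ x\<in>A. a * potential p B x \<partial>\<mu>) = a * (\<integral>\<^sup>+ x\<in>A. potential p B x \<partial>\<mu>)"
    by (simp add: nn_integral_cmult mult.assoc)
  also have "\<dots> = a * (\<integral>\<^sup>+ x\<in>B. potential p A x \<partial>\<mu>)"
    using potential_symmetric[OF \<mu>(1) A(1) B(1)] by simp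
  also have "\<dots> = (\<integral>\<^sup>+ x\<in>B. a * potential p A x \<partial>\<mu>)"
    by (simp add: nn_integral_cmult mult.assoc)
  also have "\<dots> \<le> (\<integral>\<^sup>+ x\<in>B. h x * potential p A x \<partial>\<mu>)"
    using B(2) by (intro nn_integral_mono) (auto simp: indicator_def not_less intro!: mult_right_mono)
  also have "\<dots> = (\<integral>\<^sup>+ x\<in>A. h x * potential p B x \<partial>\<mu>)"
    using potential_symmetric[OF \<nu> A(1) B(1)] dens[OF A(1) B(1)] dens[OF B(1) A(1)] by simp
  finally have le: "(\<integral>\<^sup>+ x\<in>A. a * potential p B x \<partial>\<mu>) \<le> (\<integral>\<^sup>+ x\<in>A. h x * potential p B x \<partial>\<mu>)" .
  have "(\<integral>\<^sup>+ x\<in>A. h x * potential p B x \<partial>\<mu>) < (\<integral>\<^sup>+ x\<in>A. a * potential p B x \<partial>\<mu>)"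
  proof (rule nn_integral_less)
    have hle: "h x * potential p B x * indicator A x \<le> a * indicator A x" for x
      using A(2) potential_le_1[of B x] mult_mono[of "h x" a "potential p B x" 1]
      by (auto simp: indicator_def)
    have "(\<integral>\<^sup>+ x\<in>A. h x * potential p B x \<partial>\<mu>) \<le> (\<integral>\<^sup>+ x. a * indicator A x \<partial>\<mu>)"
      by (intro nn_integral_mono hle)
    also have "\<dots> = a * emeasure \<mu> A" by (simp add: nn_integral_cmult_indicator)
    also have "\<dots> < \<infinity>" using a A(4) by (simp add: ennreal_mult_eq_top_iff less_top[symmetric])
    finally show "(\<integral>\<^sup>+ x\<in>A. h x * potential p B x \<partial>\<mu>) \<noteq> \<infinity>" by simp
    show "AE x in \<mu>. h x * potential p B x * indicator A x \<le> a * potential p B x * indicator A x"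
      using A(2) by (intro AE_I2) (auto simp: indicator_def intro!: mult_right_mono)
    show "\<not> (AE x in \<mu>. a * potential p B x * indicator A x \<le> h x * potential p B x * indicator A x)"
    proof
      assume "AE x in \<mu>. a * potential p B x * indicator A x \<le> h x * potential p B x * indicator A x"
      then have "AE x in \<mu>. x \<notin> A"
      proof eventually_elim
        case (elim x)
        have "h x * potential p B x < a * potential p B x" if "h x < a"
          using that pos[of x] potential_le_1[of B x]
          by (intro ennreal_mult_strict_right_mono) (auto simp: less_top[symmetric] top_unique)
        with elim A(2) show ?case by (auto simp: indicator_def not_le[symmetric] split: if_splits)
      qed
      then show False
        using A(3) by (subst (asm) AE_iff_measurable[OF \<open>A \<in> sets \<mu>\<close>]) (auto simp: sp)
    qed
  qed measurable
  with le show False by simp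
qed

lemma symmetrizing_absolutely_continuous:
  assumes irr: "irreducible_process X P p"
    and \<mu>: "symmetrizing p \<mu>" "emeasure \<mu> (space \<mu>) \<noteq> 0"
    and \<nu>: "symmetrizing p \<nu>" "emeasure \<nu> (space \<nu>) \<noteq> 0"
  shows "absolutely_continuous \<mu> \<nu>"
  unfolding absolutely_continuous_def
proof
  have M: "sets \<mu> = sets uborel" "sets \<nu> = sets uborel" "sigma_finite_measure \<nu>"
    using \<mu> \<nu> by (auto simp: symmetrizing_def)
  fix A assume A: "A \<in> null_sets \<mu>"
  show "A \<in> null_sets \<nu>"
  proof (rule ccontr)
    assume "A \<notin> null_sets \<nu>"
    moreover have A': "A \<in> sets uborel" using A M by auto
    ultimately have "emeasure \<nu> A \<noteq> 0" using M by (auto simp: null_sets_def)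
    then obtain S where S: "S \<in> sets borel" "S \<subseteq> A" "emeasure \<nu> S \<noteq> 0"
      by (rule inner_borel_finite[OF M(2,3) A'])
    have "emeasure \<mu> S = 0"
      using null_sets_subset[OF A, of S] S M by (auto intro: sets_uborelI)
    then show False
      using S symmetrizing_null_iff[OF irr \<mu> S(1)] symmetrizing_null_iff[OF irr \<nu> S(1)] by simp
  qed
qed

end

theorem theorem2p1:
  fixes G :: "'w measure"
    and Gt :: "real \<Rightarrow> 'w measure"
    and X :: "real \<Rightarrow> 'w \<Rightarrow> 'e::topological_space option"
    and \<theta> :: "real \<Rightarrow> 'w \<Rightarrow> 'w"
    and P :: "'e \<Rightarrow> 'w measure"
    and p :: "real \<Rightarrow> 'e \<Rightarrow> 'e measure"
    and \<mu> \<nu> :: "'e measure"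
  assumes "right_process G Gt X \<theta> P p"
    and "irreducible_process X P p"
    and "symmetrizing p \<mu>" and "emeasure \<mu> (space \<mu>) \<noteq> 0"
    and "symmetrizing p \<nu>" and "emeasure \<nu> (space \<nu>) \<noteq> 0"
  shows "\<exists>c::real. c > 0 \<and> \<nu> = scale_measure (ennreal c) \<mu>"
proof -
  interpret right_process G Gt X \<theta> P p by fact
  have M: "sets \<mu> = sets uborel" "sets \<nu> = sets uborel"
    using assms(3,5) by (auto simp: symmetrizing_def)
  interpret \<mu>: sigma_finite_measure \<mu> using assms(3) by (simp add: symmetrizing_def)
  interpret \<nu>: sigma_finite_measure \<nu> using assms(5) by (simp add: symmetrizing_def)
  have ac: "absolutely_continuous \<mu> \<nu>"
    using assms(2-6) by (rule symmetrizing_absolutely_continuous)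
  have "sets \<nu> = sets \<mu>" using M by simp
  then obtain h where h: "h \<in> borel_measurable \<mu>" "density \<mu> h = \<nu>"
    using \<mu>.Radon_Nikodym[OF ac] by auto
  have "(AE x in \<mu>. h x < a) \<or> (AE x in \<mu>. \<not> h x < a)" if "a \<noteq> \<infinity>" for a
    using density_separation[OF assms(2-4) h(1) _ that] assms(5) h(2) by simp
  then obtain c where c: "AE x in \<mu>. h x = c"
    using AE_const_of_cuts[OF assms(4)] by blast
  have \<nu>: "\<nu> = density \<mu> (\<lambda>_. c)"
    using c h by (subst h(2)[symmetric], intro density_cong) auto
  have em: "emeasure \<nu> A = c * emeasure \<mu> A" if "A \<in> sets \<mu>" for A
    unfolding \<nu> using that by (simp add: emeasure_density nn_integral_cmult_indicator)
  \<comment> \<open>The two non-degeneracy conditions: \<open>\<nu>\<close> is not trivial, and it is \<open>\<sigma>\<close>-finite.\<close>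
  have "c \<noteq> 0" using em[OF sets.top] assms(6) sets_eq_imp_space_eq[OF \<open>sets \<nu> = sets \<mu>\<close>] by auto
  moreover have "c \<noteq> \<infinity>"
  proof
    assume "c = \<infinity>"
    obtain F :: "nat \<Rightarrow> 'e set" where F: "range F \<subseteq> sets \<nu>" "(\<Union>i. F i) = space \<nu>"
      "\<And>i. emeasure \<nu> (F i) \<noteq> \<infinity>"
      using \<nu>.sigma_finite by metis
    have "F i \<in> null_sets \<mu>" for i
      using F(1) F(3)[of i] em[of "F i"] \<open>c = \<infinity>\<close> \<open>sets \<nu> = sets \<mu>\<close>
      by (auto simp: null_sets_def ennreal_top_mult split: if_splits)
    then have "(\<Union>i. F i) \<in> null_sets \<mu>" by (intro null_sets_UN)
    then show False
      using assms(4) sets_eq_imp_space_eq[OF \<open>sets \<nu> = sets \<mu>\<close>] F(2) by (auto simp: null_sets_def)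
  qed
  ultimately have "0 < enn2real c" "ennreal (enn2real c) = c"
    by (auto simp: enn2real_positive_iff less_top zero_less_iff_neq_zero)
  moreover have "\<nu> = scale_measure c \<mu>"
    using em \<open>sets \<nu> = sets \<mu>\<close> by (intro measure_eqI) auto
  ultimately show ?thesis by (intro exI[of _ "enn2real c"]) simp
qed

end
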